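(* Let $m\le 0$ be an integer. The ordinary generating function, with respect to length, of partial GDAP (including the empty path) that never go below the line $y=m$ is $$\frac{r_2^{-m}-r_2^{-1-m}-x^2}{x^3},\qquad\text{where } r_2=\frac{1+x-x^2-\sqrt{x^4-2x^3-x^2-2x+1}}{2x}.$$
   Context: A grand Dyck path with air pockets (GDAP) is a lattice path in $\mathbb{Z}^2$ starting at $(0,0)$ and ending on the $x$-axis, consisting of up-steps $U=(1,1)$ and down-steps $D_k=(1,-k)$ with $k\ge 1$, such that no two down-steps are consecutive; the path may go below the $x$-axis, and the empty path is a GDAP. A partial GDAP is a prefix (possibly empty, possibly the whole path) of a GDAP. "Never goes below the line $y=m$" means every vertex of the path has ordinate $\ge m$. The length of a path is its number of steps. The square root is the formal power series with constant term $1$, so $r_2$ is a formal power series with constant term $1$ (and hence invertible). *)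

theory Defs
  imports
    "HOL-Computational_Algebra.Formal_Laurent_Series"
    "HOL-Library.Sublist"
    Complex_Main
begin

text \<open>
  A lattice path starting at \<open>(0,0)\<close> is given by the list of its steps: \<open>U\<close> is the step
  \<open>(1,1)\<close> and \<open>D k\<close> is the step \<open>(1,-k)\<close>.  The type also contains \<open>D 0\<close>, which is excluded
  in the definition of \<open>GDAP\<close>.  As every step has horizontal part 1, the vertices of \<open>p\<close>
  are the points \<open>(i, height (take i p))\<close> for \<open>i \<le> length p\<close>.
\<close>

datatype step = U | D nat

fun rise :: "step \<Rightarrow> int" where
  "rise U = 1"
| "rise (D k) = - int k"

definition height :: "step list \<Rightarrow> int" where
  "height p = (\<Sum>s\<leftarrow>p. rise s)"

definition GDAP :: "step list set" where
  "GDAP = {p. (\<forall>k. D k \<in> set p \<longrightarrow> k \<ge> 1)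
            \<and> (\<forall>i j k. Suc i < length p \<longrightarrow> \<not> (p ! i = D j \<and> p ! Suc i = D k))
            \<and> height p = 0}"

definition partial_GDAP :: "step list set" where
  "partial_GDAP = {p. \<exists>q\<in>GDAP. prefix p q}"

definition never_below :: "int \<Rightarrow> step list \<Rightarrow> bool" where
  "never_below m p \<longleftrightarrow> (\<forall>i\<le>length p. m \<le> height (take i p))"

definition partial_GDAP_above :: "int \<Rightarrow> nat \<Rightarrow> step list set" where
  "partial_GDAP_above m n = {p \<in> partial_GDAP. length p = n \<and> never_below m p}"

definition partial_GDAP_gf :: "int \<Rightarrow> real fps" where
  "partial_GDAP_gf m = Abs_fps (\<lambda>n. of_nat (card (partial_GDAP_above m n)))"

text \<open>The counted sets are finite, so \<open>card\<close> above is a genuine count.\<close>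

lemma height_le_length: "height p \<le> int (length p)"
proof (induction p)
  case (Cons s p)
  have "rise s \<le> 1" by (cases s) auto
  with Cons show ?case by (simp add: height_def)
qed (simp add: height_def)

lemma finite_partial_GDAP_above: "finite (partial_GDAP_above m n)"
proof -
  let ?A = "insert U (D ` {..nat (int n - m)})"
  have "set p \<subseteq> ?A" if len: "length p = n" and nb: "never_below m p" for p
  proof
    fix s assume "s \<in> set p"
    then obtain i where i: "i < length p" "p ! i = s"
      by (auto simp: in_set_conv_nth)
    show "s \<in> ?A"
    proof (cases s)
      case (D k)
      have "height (take (Suc i) p) = height (take i p) - int k"
        using i D by (simp add: take_Suc_conv_app_nth height_def)
      moreover have "m \<le> height (take (Suc i) p)"
        using nb i by (simp add: never_below_def)
      moreover have "height (take i p) \<le> int n"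
        using height_le_length[of "take i p"] i len by simp
      ultimately show ?thesis using D by auto
    qed simp
  qed
  then have "partial_GDAP_above m n \<subseteq> {p. set p \<subseteq> ?A \<and> length p = n}"
    by (auto simp: partial_GDAP_above_def)
  then show ?thesis
    by (rule finite_subset) (simp add: finite_lists_length_eq)
qed

text \<open>
  \<open>fps_radical root 2\<close> takes the square root whose constant term is the real square root of
  the constant term of its argument, here 1.
\<close>

definition gdap_sqrt :: "real fps" where
  "gdap_sqrt = fps_radical root 2 (fps_X^4 - 2 * fps_X^3 - fps_X^2 - 2 * fps_X + 1)"

lemma gdap_sqrt_nth_0: "fps_nth gdap_sqrt 0 = 1"
  by (simp add: gdap_sqrt_def)

lemma gdap_sqrt_square:
  "gdap_sqrt^2 = fps_X^4 - 2 * fps_X^3 - fps_X^2 - 2 * fps_X + 1"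
  using power_radical[of "fps_X^4 - 2 * fps_X^3 - fps_X^2 - 2 * fps_X + 1 :: real fps" root 1]
  by (simp add: gdap_sqrt_def numeral_2_eq_2)

text \<open>
  Quotients are taken in the field of formal Laurent series, because \<open>/\<close> on \<open>fps\<close> discards
  the negative-exponent part of an inexact quotient.
\<close>

definition r2 :: "real fls" where
  "r2 = (1 + fls_X - fls_X^2 - fps_to_fls gdap_sqrt) / (2 * fls_X)"

end

theory Submission
  imports Defs
begin

text \<open>
  A path without consecutive down-steps can always be completed to a GDAP, so partial GDAP are
  counted by decomposing at the first step.  Let \<open>A\<^sub>h\<close> (\<open>B\<^sub>h\<close>) be the generating function of
  the continuations from height \<open>h = -m\<close> above the barrier, when the previous step was not
  (was) a down-step.  Then \<open>A\<^sub>h = 1 + x A\<^sub>h\<^sub>+\<^sub>1 + x (B\<^sub>0 + \<dots> + B\<^sub>h\<^sub>-\<^sub>1)\<close> and \<open>B\<^sub>h = 1 + x A\<^sub>h\<^sub>+\<^sub>1\<close>.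
  This system has only one power series solution, because it determines every coefficient from
  the preceding ones.  As \<open>x r\<^sup>2 - (1 + x - x\<^sup>2) r + 1 = 0\<close> for \<open>r = r\<^sub>2\<close>, the power series
  \<open>r\<^sup>h - r\<^sup>h\<^sup>-\<^sup>1 - x\<^sup>2\<close> solve the system for \<open>x\<^sup>3 A\<^sub>h\<close>.
\<close>

section \<open>Local description of partial GDAP\<close>

definition not_both_down :: "step \<Rightarrow> step \<Rightarrow> bool" where
  "not_both_down s t \<longleftrightarrow> \<not> (\<exists>j k. s = D j \<and> t = D k)"

lemma not_both_down_U [simp]: "not_both_down U t" "not_both_down s U"
  and not_both_down_D [simp]: "\<not> not_both_down (D j) (D k)"
  by (auto simp: not_both_down_def)

definition air_pocket_path :: "step list \<Rightarrow> bool" where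
  "air_pocket_path p \<longleftrightarrow> D 0 \<notin> set p \<and> successively not_both_down p"

lemma height_simps [simp]: "height [] = 0" "height (s # p) = rise s + height p"
  "height (p @ q) = height p + height q"
  by (simp_all add: height_def)

lemma GDAP_iff: "p \<in> GDAP \<longleftrightarrow> air_pocket_path p \<and> height p = 0"
proof -
  have "(\<forall>k. D k \<in> set p \<longrightarrow> k \<ge> 1) \<longleftrightarrow> D 0 \<notin> set p"
    by (metis One_nat_def Suc_leI gr0I not_one_le_zero)
  moreover have "successively not_both_down p \<longleftrightarrow>
      (\<forall>i j k. Suc i < length p \<longrightarrow> \<not> (p ! i = D j \<and> p ! Suc i = D k))"
    by (auto simp: successively_conv_nth not_both_down_def)
  ultimately show ?thesis
    by (auto simp: GDAP_def air_pocket_path_def)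
qed

text \<open>The step conditions pass to prefixes; conversely, any such path can be led back to the
  x-axis.\<close>

lemma partial_GDAP_iff: "p \<in> partial_GDAP \<longleftrightarrow> air_pocket_path p"
proof
  assume "p \<in> partial_GDAP"
  then obtain q where "air_pocket_path (p @ q)"
    by (auto simp: partial_GDAP_def GDAP_iff prefix_def)
  then show "air_pocket_path p"
    by (auto simp: air_pocket_path_def successively_append_iff)
next
  assume p: "air_pocket_path p"
  have U: "successively not_both_down (replicate n U)" for n
    by (simp add: successively_conv_nth)
  have "\<exists>q. p @ q \<in> GDAP"
  proof (cases "height p" "0 :: int" rule: linorder_cases)
    case greater
    \<comment> \<open>The \<open>U\<close> separates a possible final down-step of \<open>p\<close>
      from the closing one, which must therefore descend \<open>height p + 1\<close>.\<close>
    then have "p @ [U, D (nat (height p + 1))] \<in> GDAP"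
      using p by (auto simp: GDAP_iff air_pocket_path_def successively_append_iff)
    then show ?thesis ..
  next
    case equal
    then have "p @ [] \<in> GDAP"
      using p by (simp add: GDAP_iff)
    then show ?thesis ..
  next
    case less
    have "height (replicate n U) = int n" for n
      by (induction n) auto
    then have "p @ replicate (nat (- height p)) U \<in> GDAP"
      using p less U by (auto simp: GDAP_iff air_pocket_path_def successively_append_iff)
    then show ?thesis ..
  qed
  then show "p \<in> partial_GDAP"
    by (auto simp: partial_GDAP_def prefix_def)
qed

section \<open>Reading a path step by step above the barrier\<close>

lemma never_below_Nil [simp]: "never_below m [] \<longleftrightarrow> m \<le> 0"
  by (simp add: never_below_def)

lemma never_below_Cons [simp]:
  "never_below m (s # p) \<longleftrightarrow> m \<le> 0 \<and> never_below (m - rise s) p"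
proof -
  have "never_below m (s # p) \<longleftrightarrow> (\<forall>i<Suc (Suc (length p)). m \<le> height (take i (s # p)))"
    by (auto simp: never_below_def less_Suc_eq_le)
  also have "\<dots> \<longleftrightarrow> m \<le> 0 \<and> (\<forall>i<Suc (length p). m \<le> rise s + height (take i p))"
    by (subst All_less_Suc2) simp
  also have "\<dots> \<longleftrightarrow> m \<le> 0 \<and> never_below (m - rise s) p"
    by (auto simp: never_below_def less_Suc_eq_le algebra_simps)
  finally show ?thesis .
qed

lemma never_below_nonpos: "never_below m p \<Longrightarrow> m \<le> 0"
  by (cases p) auto

text \<open>The state is \<open>d\<close>, whether the preceding step was a down-step, and
  \<open>h\<close>, the height above the barrier. The test \<open>k \<le> h\<close> keeps
  \<open>h - k\<close> from being truncated.\<close>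

fun continuation :: "bool \<Rightarrow> nat \<Rightarrow> step list \<Rightarrow> bool" where
  "continuation d h [] \<longleftrightarrow> True"
| "continuation d h (U # p) \<longleftrightarrow> continuation False (Suc h) p"
| "continuation d h (D k # p) \<longleftrightarrow> \<not> d \<and> 1 \<le> k \<and> k \<le> h \<and> continuation True (h - k) p"

text \<open>A down-step before \<open>p\<close> is represented by \<open>D 1\<close>; any \<open>D k\<close> with \<open>k \<ge> 1\<close> would do.\<close>

lemma continuation_iff:
  "continuation d h p \<longleftrightarrow>
     air_pocket_path (if d then D 1 # p else p) \<and> never_below (- int h) p"
proof (induction d h p rule: continuation.induct)
  case (2 d h p)
  have "- int (Suc h) = - int h - 1"
    by simp
  with 2 show ?case
    by (cases p) (auto simp: air_pocket_path_def simp del: of_nat_Suc)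
next
  case (3 d h k p)
  have *: "- int h + int k = - int (h - k)" if "k \<le> h"
    using that by simp
  have **: "k \<le> h" if "never_below (- int h + int k) p"
    using never_below_nonpos[OF that] by simp
  show ?case
  proof (cases "\<not> d \<and> 1 \<le> k \<and> k \<le> h")
    case True
    then show ?thesis
      using 3 * by (cases p) (auto simp: air_pocket_path_def not_both_down_def)
  next
    case False
    then show ?thesis
      using ** by (auto simp: air_pocket_path_def not_less_eq_eq)
  qed
qed (auto simp: air_pocket_path_def)

section \<open>Counting continuations by their first step\<close>

definition paths :: "bool \<Rightarrow> nat \<Rightarrow> nat \<Rightarrow> step list set" where
  "paths d h n = {p. length p = n \<and> continuation d h p}"

lemma paths_0 [simp]: "paths d h 0 = {[]}"
  by (auto simp: paths_def)

lemma paths_True_Suc: "paths True h (Suc n) = (#) U ` paths False (Suc h) n"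
proof -
  have "p \<in> paths True h (Suc n) \<longleftrightarrow> p \<in> (#) U ` paths False (Suc h) n" for p
    by (cases "(True, h, p)" rule: continuation.cases) (auto simp: paths_def)
  then show ?thesis by blast
qed

text \<open>Down-steps are indexed by the height \<open>j\<close> that they reach, so that the
  counts become sums over \<open>j < h\<close>.\<close>

lemma paths_False_Suc:
  "paths False h (Suc n) =
     (#) U ` paths False (Suc h) n \<union> (\<Union>j<h. (#) (D (h - j)) ` paths True j n)"
proof -
  have "p \<in> paths False h (Suc n) \<longleftrightarrow>
      p \<in> (#) U ` paths False (Suc h) n \<union> (\<Union>j<h. (#) (D (h - j)) ` paths True j n)" for p
  proof (cases "(False, h, p)" rule: continuation.cases)
    case (3 d h' k q)
    have "(\<exists>j<h. k = h - j \<and> continuation True j q) \<longleftrightarrow>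
        1 \<le> k \<and> k \<le> h \<and> continuation True (h - k) q"
      by (auto intro!: exI[of _ "h - k"])
    with 3 show ?thesis
      by (auto simp: paths_def)
  qed (auto simp: paths_def)
  then show ?thesis by blast
qed

lemma finite_paths [simp]: "finite (paths d h n)"
  by (induction n arbitrary: d h)
    (case_tac d; simp add: paths_True_Suc paths_False_Suc)+

lemma card_paths_True_Suc: "card (paths True h (Suc n)) = card (paths False (Suc h) n)"
  by (simp add: paths_True_Suc card_image)

lemma card_paths_False_Suc:
  "card (paths False h (Suc n)) = card (paths False (Suc h) n) + (\<Sum>j<h. card (paths True j n))"
proof -
  \<comment> \<open>The union is disjoint because distinct \<open>j < h\<close> give distinct first
    steps \<open>D (h - j)\<close>.\<close>
  have "card (\<Union>j<h. (#) (D (h - j)) ` paths True j n) = (\<Sum>j<h. card (paths True j n))"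
    by (subst card_UN_disjoint) (auto simp: card_image)
  then show ?thesis
    unfolding paths_False_Suc by (subst card_Un_disjoint) (auto simp: card_image)
qed

lemma partial_GDAP_above_eq_paths: "partial_GDAP_above (- int h) n = paths False h n"
  by (auto simp: partial_GDAP_above_def paths_def partial_GDAP_iff continuation_iff)

section \<open>The linear system for the generating functions\<close>

lemma partial_GDAP_gf_rec:
  "partial_GDAP_gf (- int h) = 1 + fps_X * partial_GDAP_gf (- int (Suc h))
     + fps_X * (\<Sum>j<h. 1 + fps_X * partial_GDAP_gf (- int (Suc j)))"
  (is "?A h = _")
proof -
  define B where "B j = 1 + fps_X * ?A (Suc j)" for j
  have A_nth: "?A i $ k = of_nat (card (paths False i k))" for i k
    by (simp only: partial_GDAP_gf_def fps_nth_Abs_fps partial_GDAP_above_eq_paths)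
  have B_nth: "B j $ k = of_nat (card (paths True j k))" for j k
    by (cases k) (simp_all add: B_def A_nth card_paths_True_Suc del: of_nat_Suc)
  have "?A h = 1 + fps_X * ?A (Suc h) + fps_X * (\<Sum>j<h. B j)"
  proof (rule fps_ext)
    fix n
    show "?A h $ n = (1 + fps_X * ?A (Suc h) + fps_X * (\<Sum>j<h. B j)) $ n"
      by (cases n) (simp_all add: A_nth B_nth fps_sum_nth card_paths_False_Suc del: of_nat_Suc)
  qed
  then show ?thesis
    by (simp only: B_def)
qed

text \<open>The constant \<open>c\<close> is left open so that the system can be multiplied by
  \<open>fps_X^3\<close>, which avoids division in the closed form.\<close>

lemma fps_system_unique:
  fixes F G :: "nat \<Rightarrow> 'a::comm_ring_1 fps"
  assumes F: "\<And>h. F h = c + fps_X * F (Suc h) + fps_X * (\<Sum>j<h. c + fps_X * F (Suc j))"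
    and G: "\<And>h. G h = c + fps_X * G (Suc h) + fps_X * (\<Sum>j<h. c + fps_X * G (Suc j))"
  shows "F h = G h"
proof (rule fps_ext)
  fix n
  show "F h $ n = G h $ n"
  proof (induction n arbitrary: h rule: less_induct)
    case (less n)
    then show ?case
      by (subst F, subst G) (cases n; auto simp: fps_sum_nth intro!: sum.cong)
  qed
qed

section \<open>The quadratic equation and its consequences\<close>

lemma quadratic_if_sqrt_discriminant:
  fixes x r :: "'a::comm_ring_1"
  assumes "(1 + x - x^2 - 2 * x * r)^2 = x^4 - 2 * x^3 - x^2 - 2 * x + 1"
  shows "4 * x * (x * r^2 - (1 + x - x^2) * r + 1) = 0"
proof -
  \<comment> \<open>Completing the square: the discriminant \<open>(1 + x - x^2)^2 - 4 * x\<close>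
    is the radicand.\<close>
  have "4 * x * (x * r^2 - (1 + x - x^2) * r + 1)
      = (1 + x - x^2 - 2 * x * r)^2 - (x^4 - 2 * x^3 - x^2 - 2 * x + 1)"
    by (simp add: algebra_simps power2_eq_square power3_eq_cube power4_eq_xxxx)
  with assms show ?thesis by simp
qed

lemma inverse_of_quadratic_root:
  fixes x r i :: "'a::comm_ring_1"
  assumes "x * r^2 - (1 + x - x^2) * r + 1 = 0" "r * i = 1"
  shows "i = 1 + x - x^2 - x * r"
proof -
  have "x * r - (1 + x - x^2) + i =
      (x * r^2 - (1 + x - x^2) * r + 1) * i + (1 - r * i) * (x * r - (1 + x - x^2))"
    by (simp add: algebra_simps power2_eq_square)
  with assms show ?thesis by (simp add: algebra_simps)
qed

text \<open>With \<open>p\<close> for \<open>r^h\<close> and \<open>i\<close> for the inverse of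
  \<open>r\<close>, this is the difference of the equations for \<open>h + 1\<close> and
  \<open>h\<close>, in which only the last summand of the sum survives.\<close>

lemma quadratic_root_recurrence:
  fixes x r i p :: "'a::comm_ring_1"
  assumes "x * r^2 - (1 + x - x^2) * r + 1 = 0"
  shows "(r * p - r * p * i - x^2) - (p - p * i - x^2) =
    x * (r * (r * p) - r * (r * p) * i - x^2) - x * (r * p - r * p * i - x^2)
      + x * (x^3 + x * (r * p - r * p * i - x^2))"
    (is "?lhs = ?rhs")
proof -
  have "?lhs - ?rhs = (x * r^2 - (1 + x - x^2) * r + 1) * (p * i - p)"
    by (simp add: algebra_simps power2_eq_square power3_eq_cube)
  with assms show ?thesis by simp
qed

text \<open>This is \<open>r2\<close> as a power series: the numerator has constant term 1 - 1 = 0,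
  so the shift divides it exactly by \<open>fps_X\<close>.\<close>

definition r2_fps :: "real fps" where
  "r2_fps = fps_const (1 / 2) * fps_shift 1 (1 + fps_X - fps_X^2 - gdap_sqrt)"

lemma r2_fps_eq: "2 * fps_X * r2_fps = 1 + fps_X - fps_X^2 - gdap_sqrt"
proof -
  define T where "T = 1 + fps_X - fps_X^2 - gdap_sqrt"
  have X: "fps_X * fps_shift 1 T = T"
    by (rule fps_ext) (auto simp: T_def gdap_sqrt_nth_0)
  have half: "2 * fps_const (1 / 2) = (1 :: real fps)"
    by (simp add: fps_numeral_fps_const)
  have "2 * fps_X * r2_fps = (2 * fps_const (1 / 2)) * (fps_X * fps_shift 1 T)"
    unfolding r2_fps_def T_def by (simp only: mult.assoc mult.left_commute)
  then show ?thesis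
    by (simp only: half X mult_1) (simp only: T_def)
qed

lemma r2_fps_quadratic: "fps_X * r2_fps^2 - (1 + fps_X - fps_X^2) * r2_fps + 1 = 0"
proof -
  have S: "gdap_sqrt = 1 + fps_X - fps_X^2 - 2 * fps_X * r2_fps"
    using r2_fps_eq by (simp add: algebra_simps)
  have "4 * fps_X * (fps_X * r2_fps^2 - (1 + fps_X - fps_X^2) * r2_fps + 1) = 0"
    using gdap_sqrt_square unfolding S by (rule quadratic_if_sqrt_discriminant)
  then show ?thesis by simp
qed

text \<open>The constant term of the quadratic equation is \<open>- r2_fps $ 0 + 1 = 0\<close>.
  Hence \<open>r2_fps\<close> is invertible.\<close>

lemma r2_fps_nth_0: "r2_fps $ 0 = 1"
  using arg_cong[OF r2_fps_quadratic, of "\<lambda>f. f $ 0"] by simp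

lemma r2_eq: "r2 = fps_to_fls r2_fps"
proof -
  have "2 * fls_X * fps_to_fls r2_fps = fps_to_fls (2 * fps_X * r2_fps)"
    by (simp add: fls_times_fps_to_fls)
  also have "\<dots> = 1 + fls_X - fls_X^2 - fps_to_fls gdap_sqrt"
    unfolding r2_fps_eq by (simp add: fps_to_fls_power)
  finally show ?thesis
    by (simp add: r2_def field_simps)
qed

text \<open>Writing \<open>r2_fps^h * inverse r2_fps\<close> for the power with exponent
  \<open>h - 1\<close> covers \<open>h = 0\<close> as well.\<close>

lemma partial_GDAP_gf_closed_form:
  "fps_X^3 * partial_GDAP_gf (- int h) = r2_fps^h - r2_fps^h * inverse r2_fps - fps_X^2"
proof -
  define R where "R = r2_fps"
  define I where "I = inverse r2_fps"
  define F where "F h = fps_X^3 * partial_GDAP_gf (- int h)" for h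
  define G where "G h = R^h - R^h * I - fps_X^2" for h
  have RI: "R * I = 1"
    unfolding R_def I_def using r2_fps_nth_0 by (intro inverse_mult_eq_1') simp
  have quad: "fps_X * R^2 - (1 + fps_X - fps_X^2) * R + 1 = 0"
    unfolding R_def by (rule r2_fps_quadratic)
  have I: "I = 1 + fps_X - fps_X^2 - fps_X * R"
    using quad RI by (rule inverse_of_quadratic_root)
  have "F h = G h"
  proof (rule fps_system_unique[where c = "fps_X^3"])
    fix h
    show "F h = fps_X^3 + fps_X * F (Suc h) + fps_X * (\<Sum>j<h. fps_X^3 + fps_X * F (Suc j))"
      unfolding F_def
      by (subst partial_GDAP_gf_rec) (simp add: algebra_simps sum_distrib_left)
    show "G h = fps_X^3 + fps_X * G (Suc h) + fps_X * (\<Sum>j<h. fps_X^3 + fps_X * G (Suc j))"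
    proof (induction h)
      case 0
      \<comment> \<open>The sum is empty, and by the formula for \<open>I\<close> both sides equal
        \<open>fps_X * R - fps_X\<close>.\<close>
      show ?case
        using RI by (simp add: G_def I algebra_simps power2_eq_square power3_eq_cube)
    next
      case (Suc h)
      have "G (Suc h) - G h =
          fps_X * G (Suc (Suc h)) - fps_X * G (Suc h) + fps_X * (fps_X^3 + fps_X * G (Suc h))"
        unfolding G_def power_Suc using quad by (rule quadratic_root_recurrence)
      with Suc show ?case
        by (simp add: algebra_simps)
    qed
  qed
  then show ?thesis
    by (simp add: F_def G_def R_def I_def)
qed

theorem theorem3:
  fixes m :: int
  assumes "m \<le> 0"
  shows "fps_to_fls (partial_GDAP_gf m)
           = (r2 powi (-m) - r2 powi (-1 - m) - fls_X^2) / fls_X^3"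
proof -
  obtain h where m: "m = - int h"
    using assms by (metis minus_minus nonneg_int_cases neg_0_le_iff_le)
  have nz: "r2 \<noteq> 0"
    using r2_fps_nth_0 by (auto simp: r2_eq)
  have inv: "fps_to_fls (inverse r2_fps) = inverse r2"
    using r2_fps_nth_0 by (simp add: r2_eq fls_inverse_fps_to_fls)
  have "fls_X^3 * fps_to_fls (partial_GDAP_gf m) = fps_to_fls (fps_X^3 * partial_GDAP_gf m)"
    by (simp add: fls_times_fps_to_fls fps_to_fls_power)
  also have "\<dots> = r2 ^ h - r2 ^ h * inverse r2 - fls_X^2"
    unfolding m partial_GDAP_gf_closed_form
    by (simp add: fls_times_fps_to_fls fps_to_fls_power inv r2_eq)
  also have "r2 ^ h * inverse r2 = r2 powi (-1 - m)"
    using nz by (simp add: m power_int_diff power_int_minus field_simps)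
  also have "r2 ^ h = r2 powi (-m)"
    by (simp add: m)
  finally show ?thesis
    by (simp only: nonzero_eq_divide_eq[of "fls_X^3"] power_not_zero fls_X_nonzero
        not_False_eq_True mult.commute)
qed

end
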